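(* Let $(M,g)$ be the Robinson–Trautman spacetime with coordinates $(t,r,x,y)$, constants $a,b,d\in\mathbb R$ and function $f=f(x,y)$, and let $F_1=f_x^2+f_y^2-f(f_{xx}+f_{yy})$. If $b=d=0$, $F_1-2a\neq0$ and $rF_1-2ar\neq0$ on $M$, then the spacetime realizes conharmonic curvature inheritance with respect to $\xi=\frac{\partial}{\partial x}$, given by $$\mathscr L_\xi K=\frac{-4af_x+2f_y^2f_x-ff_{yy}f_x+2f_x^3-2ff_yf_{xy}+f^2f_{xyy}-3ff_xf_{xx}+f^2f_{xxx}}{f(2a-F_1)}\,K.$$
   Context: Robinson–Trautman (RT) spacetime: $a,b,d\in\mathbb R$ are constants; $M=I\times J\times\Omega$ with coordinates $(x^1,x^2,x^3,x^4)=(t,r,x,y)$, where $I\subset\mathbb R$ and $J\subset\mathbb R\setminus\{0\}$ are open intervals and $\Omega\subset\mathbb R^2$ is open, connected and nonempty; $f:\Omega\to\mathbb R$ is smooth and nowhere vanishing, with subscripts denoting partial derivatives; the metric is $$g=-2\Big(a-2br-\frac dr\Big)dt^2+2\,dt\,dr-\frac{r^2}{f^2}(dx^2+dy^2).$$ ($2\,dt\,dr$ means $g_{12}=g_{21}=1$.) Curvature conventions: with $\Gamma$ the Levi-Civita connection coefficients, $R_{pqrs}=g_{p\alpha}(\partial_r\Gamma^\alpha_{qs}-\partial_s\Gamma^\alpha_{qr}+\Gamma^\beta_{qs}\Gamma^\alpha_{\beta r}-\Gamma^\beta_{qr}\Gamma^\alpha_{\beta s})$ and $S_{qr}=g^{ps}R_{pqrs}$.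 The Kulkarni–Nomizu product is $(\phi\wedge\psi)_{pqrs}=\phi_{ps}\psi_{qr}-\phi_{pr}\psi_{qs}+\phi_{qr}\psi_{ps}-\phi_{qs}\psi_{pr}$. The conharmonic $(0,4)$ curvature tensor (dimension 4) is $K=R-\frac12\,S\wedge g$. Conharmonic inheritance with respect to $\xi$ means $\mathscr L_\xi K=\lambda K$ for a smooth function $\lambda$, where $\mathscr L_\xi$ is the Lie derivative of the $(0,4)$ tensor. *)

theory Defs
  imports "HOL-Analysis.Analysis"
begin

section \<open>Directional derivatives and smooth functions\<close>

definition dderiv :: "'a::real_normed_vector \<Rightarrow> ('a \<Rightarrow> real) \<Rightarrow> 'a \<Rightarrow> real" where
  "dderiv v f p = deriv (\<lambda>s. f (p + s *\<^sub>R v)) 0"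

text \<open>For open \<open>S\<close>, the predicate \<open>times_diff_on n S f\<close> says that \<open>f\<close> is of class \<open>C\<^sup>n\<close> on \<open>S\<close>.\<close>

primrec times_diff_on :: "nat \<Rightarrow> 'a::real_normed_vector set \<Rightarrow> ('a \<Rightarrow> real) \<Rightarrow> bool" where
  "times_diff_on 0 S f \<longleftrightarrow> continuous_on S f"
| "times_diff_on (Suc n) S f \<longleftrightarrow>
     (\<forall>p\<in>S. f differentiable (at p)) \<and> (\<forall>v. times_diff_on n S (dderiv v f))"

definition smooth_on :: "'a::real_normed_vector set \<Rightarrow> ('a \<Rightarrow> real) \<Rightarrow> bool" where
  "smooth_on S f \<longleftrightarrow> (\<forall>n. times_diff_on n S f)"

section \<open>Tensor calculus in one coordinate chart\<close>

text \<open>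
  Tensor fields on a subset of \<open>\<real>\<^sup>n\<close> are given by their components in the standard
  coordinates.  A metric is a matrix-valued function, \<open>g p $ i $ j\<close> being \<open>g\<^sub>i\<^sub>j\<close> at \<open>p\<close>.
\<close>

type_synonym 'n metric = "real ^ 'n \<Rightarrow> real ^ 'n ^ 'n"
type_synonym 'n tensor2 = "real ^ 'n \<Rightarrow> 'n \<Rightarrow> 'n \<Rightarrow> real"
type_synonym 'n tensor4 = "real ^ 'n \<Rightarrow> 'n \<Rightarrow> 'n \<Rightarrow> 'n \<Rightarrow> 'n \<Rightarrow> real"

definition pderiv_coord :: "'n::finite \<Rightarrow> (real ^ 'n \<Rightarrow> real) \<Rightarrow> real ^ 'n \<Rightarrow> real" where
  "pderiv_coord i = dderiv (axis i 1)"

definition metric_comp :: "'n::finite metric \<Rightarrow> 'n tensor2" where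
  "metric_comp g p i j = g p $ i $ j"

definition inv_metric :: "'n::finite metric \<Rightarrow> 'n tensor2" where
  "inv_metric g p i j = matrix_inv (g p) $ i $ j"

text \<open>\<open>christoffel g p k i j\<close> is \<open>\<Gamma>\<^sup>k\<^sub>i\<^sub>j\<close> at \<open>p\<close>.\<close>

definition christoffel :: "'n::finite metric \<Rightarrow> real ^ 'n \<Rightarrow> 'n \<Rightarrow> 'n \<Rightarrow> 'n \<Rightarrow> real" where
  "christoffel g p k i j =
     (1 / 2) * (\<Sum>l\<in>UNIV. inv_metric g p k l *
        (pderiv_coord i (\<lambda>x. metric_comp g x j l) p
         + pderiv_coord j (\<lambda>x. metric_comp g x i l) p
         - pderiv_coord l (\<lambda>x. metric_comp g x i j) p))"

definition riemann :: "'n::finite metric \<Rightarrow> 'n tensor4" where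
  "riemann g x p q r s =
     (\<Sum>\<alpha>\<in>UNIV. metric_comp g x p \<alpha> *
        (pderiv_coord r (\<lambda>y. christoffel g y \<alpha> q s) x
         - pderiv_coord s (\<lambda>y. christoffel g y \<alpha> q r) x
         + (\<Sum>\<beta>\<in>UNIV. christoffel g x \<beta> q s * christoffel g x \<alpha> \<beta> r
                      - christoffel g x \<beta> q r * christoffel g x \<alpha> \<beta> s)))"

definition ricci :: "'n::finite metric \<Rightarrow> 'n tensor2" where
  "ricci g x q r = (\<Sum>p\<in>UNIV. \<Sum>s\<in>UNIV. inv_metric g x p s * riemann g x p q r s)"

definition kulkarni_nomizu :: "'n::finite tensor2 \<Rightarrow> 'n tensor2 \<Rightarrow> 'n tensor4" where
  "kulkarni_nomizu \<phi> \<psi> x p q r s =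
     \<phi> x p s * \<psi> x q r - \<phi> x p r * \<psi> x q s + \<phi> x q r * \<psi> x p s - \<phi> x q s * \<psi> x p r"

text \<open>The factor \<open>1/2\<close> is \<open>1/(n - 2)\<close> in dimension \<open>n = 4\<close>.\<close>

definition conharmonic :: "4 metric \<Rightarrow> 4 tensor4" where
  "conharmonic g x p q r s =
     riemann g x p q r s - (1 / 2) * kulkarni_nomizu (ricci g) (metric_comp g) x p q r s"

definition lie_deriv4 :: "(real ^ 'n \<Rightarrow> real ^ 'n) \<Rightarrow> 'n::finite tensor4 \<Rightarrow> 'n tensor4" where
  "lie_deriv4 \<xi> T x p q r s =
     (\<Sum>\<alpha>\<in>UNIV.
        \<xi> x $ \<alpha> * pderiv_coord \<alpha> (\<lambda>y. T y p q r s) x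
        + T x \<alpha> q r s * pderiv_coord p (\<lambda>y. \<xi> y $ \<alpha>) x
        + T x p \<alpha> r s * pderiv_coord q (\<lambda>y. \<xi> y $ \<alpha>) x
        + T x p q \<alpha> s * pderiv_coord r (\<lambda>y. \<xi> y $ \<alpha>) x
        + T x p q r \<alpha> * pderiv_coord s (\<lambda>y. \<xi> y $ \<alpha>) x)"

definition coord_field :: "'n::finite \<Rightarrow> real ^ 'n \<Rightarrow> real ^ 'n" where
  "coord_field i = (\<lambda>x. axis i 1)"

definition conharmonic_inheritance ::
    "(real ^ 4) set \<Rightarrow> 4 metric \<Rightarrow> (real ^ 4 \<Rightarrow> real ^ 4) \<Rightarrow> (real ^ 4 \<Rightarrow> real) \<Rightarrow> bool" where
  "conharmonic_inheritance M g \<xi> lam \<longleftrightarrow>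
     smooth_on M lam \<and>
     (\<forall>x\<in>M. \<forall>p q r s. lie_deriv4 \<xi> (conharmonic g) x p q r s = lam x * conharmonic g x p q r s)"

section \<open>The Robinson--Trautman spacetime\<close>

text \<open>
  The coordinates \<open>(t, r, x, y)\<close> of \<open>p :: real ^ 4\<close> are \<open>p $ 1, p $ 2, p $ 3, p $ 4\<close>;
  in the index type \<open>4\<close> the numeral \<open>4\<close> equals \<open>0\<close>, so \<open>1, 2, 3, 4\<close> are exactly its elements.
\<close>

definition rt_manifold :: "real set \<Rightarrow> real set \<Rightarrow> (real \<times> real) set \<Rightarrow> (real ^ 4) set" where
  "rt_manifold I J \<Omega> = {p. p $ 1 \<in> I \<and> p $ 2 \<in> J \<and> (p $ 3, p $ 4) \<in> \<Omega>}"

definition rt_metric :: "real \<Rightarrow> real \<Rightarrow> real \<Rightarrow> (real \<times> real \<Rightarrow> real) \<Rightarrow> 4 metric" where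
  "rt_metric a b d f p =
     (let r = p $ 2; h = - (r ^ 2 / (f (p $ 3, p $ 4)) ^ 2) in
      vector [vector [- 2 * (a - 2 * b * r - d / r), 1, 0, 0],
              vector [1, 0, 0, 0],
              vector [0, 0, h, 0],
              vector [0, 0, 0, h]])"

definition Dx :: "(real \<times> real \<Rightarrow> real) \<Rightarrow> real \<times> real \<Rightarrow> real" where
  "Dx = dderiv (1, 0)"

definition Dy :: "(real \<times> real \<Rightarrow> real) \<Rightarrow> real \<times> real \<Rightarrow> real" where
  "Dy = dderiv (0, 1)"

definition F1 :: "(real \<times> real \<Rightarrow> real) \<Rightarrow> real \<times> real \<Rightarrow> real" where
  "F1 f z = (Dx f z) ^ 2 + (Dy f z) ^ 2 - f z * (Dx (Dx f) z + Dy (Dy f) z)"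

end

theory Submission
  imports Defs
begin

text \<open>
  For \<open>b = d = 0\<close> the metric is a warped product: the base is the \<open>(t, r)\<close>-plane with the
  \<^emph>\<open>constant\<close>, hence flat, metric \<open>\<gamma> = - 2 a dt\<^sup>2 + 2 dt dr\<close>, and the fibre is \<open>\<Omega>\<close> with
  \<open>- (dx\<^sup>2 + dy\<^sup>2) / f\<^sup>2\<close>, scaled by \<open>r\<^sup>2\<close>.  The warping function \<open>r\<close> is linear in the flat
  coordinates of the base, so its Hessian vanishes, and the only curvature left is that of the
  fibre plane, corrected by \<open>\<bar>dr\<bar>\<^sup>2 = 2 a\<close>.  With \<open>\<pi> = dx\<^sup>2 + dy\<^sup>2\<close> and
  \<open>\<rho> = (F\<^sub>1 - 2 a) / f\<^sup>2\<close> this means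
  \<open>R\<^sup>i\<^sub>j\<^sub>k\<^sub>l = \<rho> (\<pi>\<^sub>i\<^sub>l \<pi>\<^sub>j\<^sub>k - \<pi>\<^sub>i\<^sub>k \<pi>\<^sub>j\<^sub>l)\<close> (lemma \<open>curvature_operator\<close>) and \<open>S = \<rho> \<pi>\<close>.

  Write \<open>g = \<gamma> - (r\<^sup>2 / f\<^sup>2) \<pi>\<close>.  In \<open>K = R - (1/2) S \<and> g\<close> the multiple of \<open>\<pi> \<and> \<pi>\<close> contributed by \<open>S\<close>
  cancels \<open>R\<close>, since an algebraic curvature tensor on a plane is determined by its trace.  What remains is
  \<open>K = - (1/2) \<rho> (\<pi> \<and> \<gamma>)\<close> (lemma \<open>conharmonic_rt\<close>): a function of \<open>(x, y)\<close> times a tensor with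
  constant components.  Since \<open>\<partial>/\<partial>x\<close> has constant components, the Lie derivative \<open>L\<close> along it acts on
  components as \<open>\<partial>\<^sub>x\<close>, so \<open>L K = (\<partial>\<^sub>x \<rho> / \<rho>) K\<close>.  The stated factor is the logarithmic
  derivative of \<open>\<rho>\<close> written out (lemma \<open>Dx_curvature_scalar\<close>).

  Schwarz's theorem (lemma \<open>dderiv_commute\<close>) enters twice: mixed second derivatives of \<open>f\<close> drop
  out of the curvature, and \<open>\<partial>\<^sub>x \<partial>\<^sub>y \<partial>\<^sub>y f\<close>, which arises from \<open>\<partial>\<^sub>x F\<^sub>1\<close>, becomes the
  \<open>\<partial>\<^sub>y \<partial>\<^sub>y \<partial>\<^sub>x f\<close> of the stated factor.
\<close>

section \<open>Calculus of directional derivatives\<close>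

text \<open>
  The directional derivative only looks along a line through the point.  For
  differentiable functions it is the derivative of the restriction at every parameter of the
  line, which is what the mean value theorem asks for.
\<close>
lemma has_dderiv_line:
  assumes "f differentiable (at (p + s *\<^sub>R v))"
  shows "((\<lambda>t. f (p + t *\<^sub>R v)) has_real_derivative dderiv v f (p + s *\<^sub>R v)) (at s)"
proof -
  obtain f' where f': "(f has_derivative f') (at (p + s *\<^sub>R v))"
    using assms by (auto simp: differentiable_def)
  have lin: "f' (t *\<^sub>R v) = f' v * t" for t
    using linear_cmul[OF has_derivative_linear[OF f']] by (simp add: mult.commute)
  have along: "((\<lambda>t. f (q + t *\<^sub>R v)) has_real_derivative f' v) (at s')"
    if "q + s' *\<^sub>R v = p + s *\<^sub>R v" for q s'
  proof -
    have "((\<lambda>t. f (q + t *\<^sub>R v)) has_derivative (\<lambda>t. f' (t *\<^sub>R v))) (at s')"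
      by (rule has_derivative_compose[of "\<lambda>t. q + t *\<^sub>R v"])
         (auto intro!: derivative_eq_intros f' simp: that)
    then show ?thesis
      by (simp add: has_field_derivative_def lin)
  qed
  have "dderiv v f (p + s *\<^sub>R v) = f' v"
    unfolding dderiv_def by (rule DERIV_imp_deriv, rule along) simp
  then show ?thesis
    using along by simp
qed

lemma has_dderiv:
  assumes "f differentiable (at p)"
  shows "((\<lambda>t. f (p + t *\<^sub>R v)) has_real_derivative dderiv v f p) (at 0)"
  using has_dderiv_line[of f p 0 v] assms by simp

lemma dderiv_eqI:
  "((\<lambda>t. f (p + t *\<^sub>R v)) has_real_derivative d) (at 0) \<Longrightarrow> dderiv v f p = d"
  unfolding dderiv_def by (rule DERIV_imp_deriv)

text \<open>
  The derivatives of a tensor component need its values near the point, and formulas for the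
  components are available on an open chart only.
\<close>
lemma dderiv_cong:
  assumes "open S" "p \<in> S" "\<And>q. q \<in> S \<Longrightarrow> f q = g q"
  shows "dderiv v f p = dderiv v g p"
proof -
  have "((\<lambda>s. p + s *\<^sub>R v) \<longlongrightarrow> p) (nhds 0)"
    by (auto intro!: tendsto_eq_intros filterlim_ident)
  then have "\<forall>\<^sub>F s in nhds 0. p + s *\<^sub>R v \<in> S"
    using assms(1,2) by (rule topological_tendstoD)
  then have "\<forall>\<^sub>F s in nhds 0. f (p + s *\<^sub>R v) = g (p + s *\<^sub>R v)"
    by eventually_elim (rule assms(3))
  then show ?thesis
    unfolding dderiv_def by (intro deriv_cong_ev refl)
qed

lemma dderiv_const [simp]: "dderiv v (\<lambda>p. c) p = 0"
  by (rule dderiv_eqI) simp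

lemma dderiv_add:
  "f differentiable (at p) \<Longrightarrow> g differentiable (at p) \<Longrightarrow>
    dderiv v (\<lambda>q. f q + g q) p = dderiv v f p + dderiv v g p"
  by (rule dderiv_eqI, rule DERIV_add) (auto intro: has_dderiv)

lemma dderiv_mult:
  "f differentiable (at p) \<Longrightarrow> g differentiable (at p) \<Longrightarrow>
    dderiv v (\<lambda>q. f q * g q) p = dderiv v f p * g p + dderiv v g p * f p"
  using DERIV_mult[OF has_dderiv[of f p v] has_dderiv[of g p v]] by (intro dderiv_eqI) simp

lemma dderiv_inverse:
  "f differentiable (at p) \<Longrightarrow> f p \<noteq> 0 \<Longrightarrow>
    dderiv v (\<lambda>q. inverse (f q)) p = - (inverse (f p) * dderiv v f p * inverse (f p))"
  using DERIV_inverse'[OF has_dderiv[of f p v]] by (intro dderiv_eqI) simp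

text \<open>
  A linear map sends the line through \<open>p\<close> in direction \<open>v\<close> to the
  line through \<open>L p\<close> in direction \<open>L v\<close>, so the two restrictions are the same function.
\<close>
lemma dderiv_compose_linear:
  assumes "linear L"
  shows "dderiv v (\<lambda>p. f (L p)) p = dderiv (L v) f (L p)"
  by (simp add: dderiv_def linear_add[OF assms] linear_cmul[OF assms])

section \<open>Closure properties of smooth functions\<close>

text \<open>
  The rules of differentiation hold only where the functions are differentiable, so each
  closure proof below establishes the derivative formula on \<open>S\<close> and transports smoothness along it.
\<close>
lemma times_diff_on_cong:
  assumes "open S" "\<And>q. q \<in> S \<Longrightarrow> f q = g q" "times_diff_on n S f"
  shows "times_diff_on n S g"
  using assms(2,3)
proof (induction n arbitrary: f g)
  case 0
  then show ?case by (simp cong: continuous_on_cong)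
next
  case (Suc n)
  have "g differentiable (at p)" if "p \<in> S" for p
  proof -
    obtain f' where "(f has_derivative f') (at p)"
      using Suc.prems(2) \<open>p \<in> S\<close> by (auto simp: differentiable_def)
    then have "(g has_derivative f') (at p)"
      by (rule has_derivative_transform_within_open[OF _ assms(1) \<open>p \<in> S\<close> Suc.prems(1)])
    then show ?thesis by (auto simp: differentiable_def)
  qed
  moreover have "times_diff_on n S (dderiv v g)" for v
  proof (rule Suc.IH)
    show "dderiv v f q = dderiv v g q" if "q \<in> S" for q
      by (rule dderiv_cong[OF assms(1) that Suc.prems(1)])
    show "times_diff_on n S (dderiv v f)"
      using Suc.prems(2) by simp
  qed
  ultimately show ?case by simp
qed

lemma times_diff_on_Suc_D: "times_diff_on (Suc n) S f \<Longrightarrow> times_diff_on n S f"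
proof (induction n arbitrary: f)
  case 0
  then show ?case
    by (simp add: differentiable_imp_continuous_on differentiable_at_imp_differentiable_on)
next
  case (Suc n)
  have "times_diff_on n S (dderiv v f)" for v
    by (rule Suc.IH) (use Suc.prems in simp)
  then show ?case using Suc.prems by simp
qed

lemma times_diff_on_const: "times_diff_on n S (\<lambda>p. c)"
proof (induction n arbitrary: c)
  case (Suc n)
  have "dderiv v (\<lambda>p::'a. c) = (\<lambda>p. 0)" for v by (rule ext) simp
  with Suc show ?case by simp
qed simp

lemma times_diff_on_add:
  assumes "open S" "times_diff_on n S f" "times_diff_on n S g"
  shows "times_diff_on n S (\<lambda>p. f p + g p)"
  using assms(2,3)
proof (induction n arbitrary: f g)
  case 0
  then show ?case by (simp add: continuous_on_add)
next
  case (Suc n)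
  have "times_diff_on n S (dderiv v (\<lambda>p. f p + g p))" for v
  proof (rule times_diff_on_cong[OF assms(1)])
    show "times_diff_on n S (\<lambda>p. dderiv v f p + dderiv v g p)"
      using Suc by simp
    show "dderiv v f p + dderiv v g p = dderiv v (\<lambda>p. f p + g p) p" if "p \<in> S" for p
      using Suc.prems that by (simp add: dderiv_add)
  qed
  with Suc.prems show ?case by simp
qed

lemma times_diff_on_mult:
  assumes "open S" "times_diff_on n S f" "times_diff_on n S g"
  shows "times_diff_on n S (\<lambda>p. f p * g p)"
  using assms(2,3)
proof (induction n arbitrary: f g)
  case 0
  then show ?case by (simp add: continuous_on_mult)
next
  case (Suc n)
  have "times_diff_on n S (dderiv v (\<lambda>p. f p * g p))" for v
  proof (rule times_diff_on_cong[OF assms(1)])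
    show "times_diff_on n S (\<lambda>p. dderiv v f p * g p + f p * dderiv v g p)"
      using Suc.prems Suc.prems[THEN times_diff_on_Suc_D]
      by (simp add: times_diff_on_add[OF assms(1)] Suc.IH)
    show "dderiv v f p * g p + f p * dderiv v g p = dderiv v (\<lambda>p. f p * g p) p" if "p \<in> S" for p
      using Suc.prems that by (simp add: dderiv_mult)
  qed
  with Suc.prems show ?case by simp
qed

lemma times_diff_on_inverse:
  assumes "open S" "times_diff_on n S f" "\<And>p. p \<in> S \<Longrightarrow> f p \<noteq> 0"
  shows "times_diff_on n S (\<lambda>p. inverse (f p))"
  using assms(2)
proof (induction n)
  case 0
  then show ?case using assms(3) by (simp add: continuous_on_inverse)
next
  case (Suc n)
  have inv: "times_diff_on n S (\<lambda>p. inverse (f p))"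
    using Suc.IH[OF times_diff_on_Suc_D[OF Suc.prems]] .
  have "times_diff_on n S (dderiv v (\<lambda>p. inverse (f p)))" for v
  proof (rule times_diff_on_cong[OF assms(1)])
    show "times_diff_on n S (\<lambda>p. (- 1) * (inverse (f p) * (dderiv v f p * inverse (f p))))"
      using Suc.prems by (simp only: times_diff_on_mult[OF assms(1)] times_diff_on_const inv times_diff_on.simps)
    show "(- 1) * (inverse (f p) * (dderiv v f p * inverse (f p))) = dderiv v (\<lambda>p. inverse (f p)) p"
      if "p \<in> S" for p
      using Suc.prems that assms(3) by (simp add: dderiv_inverse)
  qed
  with Suc.prems assms(3) show ?case by simp
qed

lemma times_diff_on_compose_linear:
  assumes "bounded_linear L"
  shows "times_diff_on n S f \<Longrightarrow> L ` T \<subseteq> S \<Longrightarrow> times_diff_on n T (\<lambda>p. f (L p))"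
proof (induction n arbitrary: f)
  case 0
  then show ?case
    using continuous_on_compose2[of S f T L] linear_continuous_on[OF assms] by simp
next
  case (Suc n)
  have "(\<lambda>p. f (L p)) differentiable (at p)" if "p \<in> T" for p
    by (rule differentiable_compose[of f L])
       (use Suc.prems that bounded_linear_imp_differentiable[OF assms] in \<open>auto simp: image_subset_iff\<close>)
  moreover have "dderiv v (\<lambda>p. f (L p)) = (\<lambda>p. dderiv (L v) f (L p))" for v
    using dderiv_compose_linear[OF bounded_linear.linear[OF assms]] by blast
  ultimately show ?case
    using Suc by simp
qed

named_theorems smooth_intros

lemma smooth_on_const [smooth_intros]: "smooth_on S (\<lambda>p. c)"
  by (simp add: smooth_on_def times_diff_on_const)

lemma smooth_on_add [smooth_intros]:
  "open S \<Longrightarrow> smooth_on S f \<Longrightarrow> smooth_on S g \<Longrightarrow> smooth_on S (\<lambda>p. f p + g p)"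
  by (simp add: smooth_on_def times_diff_on_add)

lemma smooth_on_mult [smooth_intros]:
  "open S \<Longrightarrow> smooth_on S f \<Longrightarrow> smooth_on S g \<Longrightarrow> smooth_on S (\<lambda>p. f p * g p)"
  by (simp add: smooth_on_def times_diff_on_mult)

lemma smooth_on_diff [smooth_intros]:
  assumes "open S" "smooth_on S f" "smooth_on S g"
  shows "smooth_on S (\<lambda>p. f p - g p)"
  using smooth_on_add[OF assms(1,2) smooth_on_mult[OF assms(1) smooth_on_const[of S "- 1"] assms(3)]]
  by simp

lemma smooth_on_power [smooth_intros]:
  "open S \<Longrightarrow> smooth_on S f \<Longrightarrow> smooth_on S (\<lambda>p. f p ^ n)"
  by (induction n) (auto intro: smooth_intros)

lemma smooth_on_divide [smooth_intros]:
  assumes "open S" "smooth_on S f" "smooth_on S g" "\<And>p. p \<in> S \<Longrightarrow> g p \<noteq> 0"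
  shows "smooth_on S (\<lambda>p. f p / g p)"
  unfolding divide_inverse
  by (intro smooth_on_mult assms) (use assms in \<open>simp add: smooth_on_def times_diff_on_inverse\<close>)

lemma smooth_on_dderiv [smooth_intros]: "smooth_on S f \<Longrightarrow> smooth_on S (dderiv v f)"
  by (metis smooth_on_def times_diff_on.simps(2))

lemma smooth_on_compose_linear:
  "bounded_linear L \<Longrightarrow> smooth_on S f \<Longrightarrow> L ` T \<subseteq> S \<Longrightarrow> smooth_on T (\<lambda>p. f (L p))"
  by (auto simp: smooth_on_def intro: times_diff_on_compose_linear)

lemma smooth_on_differentiable: "smooth_on S f \<Longrightarrow> p \<in> S \<Longrightarrow> f differentiable (at p)"
  by (metis smooth_on_def times_diff_on.simps(2))

lemma smooth_on_continuous: "smooth_on S f \<Longrightarrow> continuous_on S f"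
  by (metis smooth_on_def times_diff_on.simps(1))

section \<open>Symmetry of second derivatives\<close>

text \<open>
  The mean value theorem is applied in direction \<open>u\<close> to \<open>x \<mapsto> f (x + h v) - f x\<close>, then in
  direction \<open>v\<close> to \<open>D\<^sub>u f\<close>.  The left-hand side is symmetric in \<open>u\<close> and \<open>v\<close>.
\<close>
lemma second_difference_mean_value:
  assumes "0 < h" and "smooth_on S f"
    and "\<And>s t. 0 \<le> s \<Longrightarrow> s \<le> h \<Longrightarrow> 0 \<le> t \<Longrightarrow> t \<le> h \<Longrightarrow> p + s *\<^sub>R u + t *\<^sub>R v \<in> S"
  obtains s t where "0 < s" "s < h" "0 < t" "t < h"
    "f (p + h *\<^sub>R u + h *\<^sub>R v) - f (p + h *\<^sub>R u) - f (p + h *\<^sub>R v) + f p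
       = h\<^sup>2 * dderiv v (dderiv u f) (p + s *\<^sub>R u + t *\<^sub>R v)"
proof -
  have line: "((\<lambda>s. f (p + t *\<^sub>R v + s *\<^sub>R u)) has_real_derivative
      dderiv u f (p + t *\<^sub>R v + s *\<^sub>R u)) (at s)"
    if "0 \<le> s" "s \<le> h" "0 \<le> t" "t \<le> h" for s t
    by (rule has_dderiv_line, rule smooth_on_differentiable[OF assms(2)])
       (use assms(3)[OF that] in \<open>simp add: ac_simps\<close>)
  let ?\<phi> = "\<lambda>s. f (p + h *\<^sub>R v + s *\<^sub>R u) - f (p + 0 *\<^sub>R v + s *\<^sub>R u)"
  have "\<exists>s>0. s < h \<and> ?\<phi> h - ?\<phi> 0 = (h - 0) *
      (dderiv u f (p + h *\<^sub>R v + s *\<^sub>R u) - dderiv u f (p + 0 *\<^sub>R v + s *\<^sub>R u))"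
    by (rule MVT2[OF assms(1)], intro DERIV_diff line) (use assms(1) in simp_all)
  then obtain s where s: "0 < s" "s < h" "?\<phi> h - ?\<phi> 0 = h *
      (dderiv u f (p + s *\<^sub>R u + h *\<^sub>R v) - dderiv u f (p + s *\<^sub>R u + 0 *\<^sub>R v))"
    by (auto simp: ac_simps)
  have "\<exists>t>0. t < h \<and> dderiv u f (p + s *\<^sub>R u + h *\<^sub>R v) - dderiv u f (p + s *\<^sub>R u + 0 *\<^sub>R v)
      = (h - 0) * dderiv v (dderiv u f) (p + s *\<^sub>R u + t *\<^sub>R v)"
    by (rule MVT2)
       (use assms(1) s in \<open>auto intro!: has_dderiv_line smooth_on_differentiable[of S]
          smooth_on_dderiv assms(2) assms(3)\<close>)
  then obtain t where t: "0 < t" "t < h"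
      "dderiv u f (p + s *\<^sub>R u + h *\<^sub>R v) - dderiv u f (p + s *\<^sub>R u + 0 *\<^sub>R v)
        = h * dderiv v (dderiv u f) (p + s *\<^sub>R u + t *\<^sub>R v)"
    by auto
  show thesis
    by (rule that[OF s(1,2) t(1,2)])
       (use s(3) t(3) in \<open>simp add: power2_eq_square algebra_simps\<close>)
qed

text \<open>
  The two ways of evaluating the second difference give points arbitrarily close to \<open>p\<close> at
  which the two mixed derivatives coincide; continuity carries this over to \<open>p\<close>.
\<close>
lemma dderiv_commute:
  assumes "open S" "p \<in> S" "smooth_on S f"
  shows "dderiv v (dderiv u f) p = dderiv u (dderiv v f) p"
proof -
  let ?A = "dderiv v (dderiv u f)" and ?B = "dderiv u (dderiv v f)"
  have "dist (?A p) (?B p) \<le> e" if "e > 0" for e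
  proof -
    have "isCont ?A p" "isCont ?B p"
      using assms by (auto simp: continuous_on_eq_continuous_at
        intro!: smooth_on_dderiv dest!: smooth_on_continuous[OF smooth_on_dderiv[OF smooth_on_dderiv]])
    then have "(?A \<longlongrightarrow> ?A p) (nhds p)" "(?B \<longlongrightarrow> ?B p) (nhds p)"
      by (simp_all add: isCont_def tendsto_at_iff_tendsto_nhds)
    then have "\<forall>\<^sub>F q in nhds p. dist (?A q) (?A p) < e / 2"
      "\<forall>\<^sub>F q in nhds p. dist (?B q) (?B p) < e / 2"
      using \<open>e > 0\<close> half_gt_zero tendstoD by blast+
    moreover have "\<forall>\<^sub>F q in nhds p. q \<in> S"
      using assms by (simp add: eventually_nhds_in_open)
    ultimately have "\<forall>\<^sub>F q in nhds p. q \<in> S \<and> dist (?A q) (?A p) < e / 2 \<and> dist (?B q) (?B p) < e / 2"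
      by eventually_elim auto
    then obtain \<delta> where \<delta>: "\<delta> > 0"
      "\<And>q. dist q p < \<delta> \<Longrightarrow> q \<in> S \<and> dist (?A q) (?A p) < e / 2 \<and> dist (?B q) (?B p) < e / 2"
      by (auto simp: eventually_nhds_metric)
    \<comment> \<open>Small enough that the parallelogram spanned by \<open>h u\<close> and \<open>h v\<close> stays within \<open>\<delta>\<close> of \<open>p\<close>.\<close>
    define h where "h = \<delta> / (norm u + norm v + 1)"
    have h: "h > 0" "h * (norm u + norm v) < \<delta>"
      using \<delta>(1) by (auto simp: h_def field_simps add_pos_nonneg intro!: divide_pos_pos)
    have near: "dist (p + s *\<^sub>R u + t *\<^sub>R v) p < \<delta>" "dist (p + t *\<^sub>R v + s *\<^sub>R u) p < \<delta>"
      if "0 \<le> s" "s \<le> h" "0 \<le> t" "t \<le> h" for s t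
    proof -
      have "norm (s *\<^sub>R u + t *\<^sub>R v) \<le> s * norm u + t * norm v"
        using that by (metis abs_of_nonneg norm_scaleR norm_triangle_ineq)
      also have "\<dots> \<le> h * norm u + h * norm v"
        using that by (intro add_mono mult_right_mono) auto
      finally have "norm (s *\<^sub>R u + t *\<^sub>R v) < \<delta>"
        using h by (simp add: algebra_simps)
      then show "dist (p + s *\<^sub>R u + t *\<^sub>R v) p < \<delta>" "dist (p + t *\<^sub>R v + s *\<^sub>R u) p < \<delta>"
        by (simp_all add: dist_norm ac_simps)
    qed
    obtain s t where st: "0 < s" "s < h" "0 < t" "t < h"
      "f (p + h *\<^sub>R u + h *\<^sub>R v) - f (p + h *\<^sub>R u) - f (p + h *\<^sub>R v) + f p
         = h\<^sup>2 * ?A (p + s *\<^sub>R u + t *\<^sub>R v)"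
      by (rule second_difference_mean_value[OF h(1) assms(3), of p u v]) (use near \<delta> in auto)
    obtain s' t' where st': "0 < s'" "s' < h" "0 < t'" "t' < h"
      "f (p + h *\<^sub>R v + h *\<^sub>R u) - f (p + h *\<^sub>R v) - f (p + h *\<^sub>R u) + f p
         = h\<^sup>2 * ?B (p + s' *\<^sub>R v + t' *\<^sub>R u)"
      by (rule second_difference_mean_value[OF h(1) assms(3), of p v u]) (use near \<delta> in auto)
    have "h\<^sup>2 * ?A (p + s *\<^sub>R u + t *\<^sub>R v) = h\<^sup>2 * ?B (p + s' *\<^sub>R v + t' *\<^sub>R u)"
      using st(5) st'(5) by (simp add: algebra_simps)
    then have "?A (p + s *\<^sub>R u + t *\<^sub>R v) = ?B (p + s' *\<^sub>R v + t' *\<^sub>R u)"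
      using h(1) by simp
    moreover have "dist (?A (p + s *\<^sub>R u + t *\<^sub>R v)) (?A p) < e / 2"
      "dist (?B (p + s' *\<^sub>R v + t' *\<^sub>R u)) (?B p) < e / 2"
      using near \<delta>(2) st(1-4) st'(1-4) by auto
    ultimately show ?thesis
      unfolding dist_real_def by linarith
  qed
  then show ?thesis
    by (metis dist_le_zero_iff field_le_epsilon add_0)
qed

section \<open>Coordinate tensor calculus\<close>

lemma pderiv_coord_cong:
  "open S \<Longrightarrow> p \<in> S \<Longrightarrow> (\<And>q. q \<in> S \<Longrightarrow> f q = g q) \<Longrightarrow> pderiv_coord i f p = pderiv_coord i g p"
  unfolding pderiv_coord_def by (rule dderiv_cong)

text \<open>The components of a coordinate field are constant, so only the transport term survives.\<close>
lemma lie_deriv4_coord_field: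
  "lie_deriv4 (coord_field i) T x p q r s = pderiv_coord i (\<lambda>y. T y p q r s) x"
proof -
  have "axis i (1::real) $ \<alpha> * c = (if i = \<alpha> then c else 0)" for \<alpha> c
    by (simp add: axis_def)
  then show ?thesis
    by (simp add: lie_deriv4_def coord_field_def pderiv_coord_def sum.distrib)
qed

lemma matrix_inv_eqI:
  fixes A :: "real ^ 'n ^ 'n"
  assumes "A ** B = mat 1"
  shows "matrix_inv A = B"
proof -
  have BA: "B ** A = mat 1"
    using assms matrix_left_right_inverse by blast
  with assms have "\<exists>A'. A ** A' = mat 1 \<and> A' ** A = mat 1"
    by blast
  then have "A ** matrix_inv A = mat 1 \<and> matrix_inv A ** A = mat 1"
    unfolding matrix_inv_def by (rule someI_ex)
  then show ?thesis
    by (metis assms matrix_mul_assoc matrix_mul_lid matrix_mul_rid)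
qed

lemma vector_4 [simp]:
  "(vector [a, b, c, d] :: 'a::zero ^ 4) $ 1 = a"
  "(vector [a, b, c, d] :: 'a::zero ^ 4) $ 2 = b"
  "(vector [a, b, c, d] :: 'a::zero ^ 4) $ 3 = c"
  "(vector [a, b, c, d] :: 'a::zero ^ 4) $ 4 = d"
  unfolding vector_def by auto

section \<open>The metric as a warped product over a flat base\<close>

text \<open>These are the components of \<open>\<pi> = dx\<^sup>2 + dy\<^sup>2\<close>.\<close>
definition angular :: "4 \<Rightarrow> 4 \<Rightarrow> real" where
  "angular i j = (if i = j \<and> (i = 3 \<or> i = 4) then 1 else 0)"

definition base_metric :: "real \<Rightarrow> 4 \<Rightarrow> 4 \<Rightarrow> real" where
  "base_metric a i j = vector [vector [- 2 * a, 1, 0, 0], vector [1, 0, 0, 0], 0, 0] $ i $ j"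

text \<open>The inverse is taken in the \<open>(t, r)\<close>-block alone and extended by zero.\<close>
definition inv_base_metric :: "real \<Rightarrow> 4 \<Rightarrow> 4 \<Rightarrow> real" where
  "inv_base_metric a i j = vector [vector [0, 1, 0, 0], vector [1, 2 * a, 0, 0], 0, 0] $ i $ j"

locale rt_flat_base =
  fixes a :: real and I J :: "real set" and \<Omega> :: "(real \<times> real) set"
    and f :: "real \<times> real \<Rightarrow> real"
  assumes open_I: "open I" and open_J: "open J" and open_\<Omega>: "open \<Omega>"
    and J_nonzero: "0 \<notin> J" and f_nonzero: "\<And>z. z \<in> \<Omega> \<Longrightarrow> f z \<noteq> 0"
    and smooth_f: "smooth_on \<Omega> f"
begin

abbreviation "M \<equiv> rt_manifold I J \<Omega>"
abbreviation "g \<equiv> rt_metric a 0 0 f"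

text \<open>
  On the four-dimensional chart, \<open>u\<close> is \<open>f\<close> and \<open>\<phi>\<close>, \<open>\<phi>\<phi>\<close> are its first and second
  coordinate derivatives.  Indexing these by all four coordinates, with zeros for \<open>t\<close> and \<open>r\<close>,
  lets one formula cover all components.
\<close>
definition u :: "real ^ 4 \<Rightarrow> real" where "u p = f (p $ 3, p $ 4)"
abbreviation "\<phi> i \<equiv> pderiv_coord i u"
abbreviation "\<phi>\<phi> i j \<equiv> pderiv_coord i (\<phi> j)"

lemma open_M: "open M"
proof -
  have "M = (\<lambda>p. p $ 1) -` I \<inter> (\<lambda>p. p $ 2) -` J \<inter> (\<lambda>p. (p $ 3, p $ 4)) -` \<Omega>"
    by (auto simp: rt_manifold_def)
  then show ?thesis
    by (simp only:) (intro open_Int open_vimage open_I open_J open_\<Omega> continuous_intros)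
qed

lemma pderiv_pullback:
  fixes p :: "real ^ 4"
  shows
  "pderiv_coord 1 (\<lambda>p. h (p $ 3, p $ 4)) p = 0"
  "pderiv_coord 2 (\<lambda>p. h (p $ 3, p $ 4)) p = 0"
  "pderiv_coord 3 (\<lambda>p. h (p $ 3, p $ 4)) p = Dx h (p $ 3, p $ 4)"
  "pderiv_coord 4 (\<lambda>p. h (p $ 3, p $ 4)) p = Dy h (p $ 3, p $ 4)"
  by (simp_all add: pderiv_coord_def dderiv_def Dx_def Dy_def axis_def)

lemma smooth_on_pullback:
  "smooth_on \<Omega> h \<Longrightarrow> smooth_on M (\<lambda>p. h (p $ 3, p $ 4))"
  by (rule smooth_on_compose_linear[where L = "\<lambda>p. (p $ 3, p $ 4)"])
     (auto simp: rt_manifold_def intro: bounded_linear_Pair bounded_linear_vec_nth)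

lemma smooth_u: "smooth_on M u"
  unfolding u_def[abs_def] by (rule smooth_on_pullback[OF smooth_f])

lemma smooth_\<phi>: "smooth_on M (\<phi> i)"
  unfolding pderiv_coord_def by (rule smooth_on_dderiv[OF smooth_u])

lemma nonzero: "p \<in> M \<Longrightarrow> u p \<noteq> 0" "p \<in> M \<Longrightarrow> p $ 2 \<noteq> 0"
  using f_nonzero J_nonzero by (auto simp: u_def rt_manifold_def)

lemma \<phi>_simps: "\<phi> 1 p = 0" "\<phi> 2 p = 0"
  by (simp_all add: u_def[abs_def] pderiv_pullback)

lemma \<phi>\<phi>_simps: "\<phi>\<phi> i 1 p = 0" "\<phi>\<phi> i 2 p = 0" "\<phi>\<phi> 1 j p = 0" "\<phi>\<phi> 2 j p = 0"
proof -
  have "\<phi> 1 = (\<lambda>p. 0)" "\<phi> 2 = (\<lambda>p. 0)" by (auto simp: \<phi>_simps)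
  then show 1: "\<phi>\<phi> i 1 p = 0" "\<phi>\<phi> i 2 p = 0" for i
    by (simp_all add: pderiv_coord_def)
  have *: "\<phi> 3 = (\<lambda>p. Dx f (p $ 3, p $ 4))" "\<phi> 4 = (\<lambda>p. Dy f (p $ 3, p $ 4))"
    by (auto simp: u_def[abs_def] pderiv_pullback)
  show "\<phi>\<phi> 1 j p = 0" "\<phi>\<phi> 2 j p = 0"
    using exhaust_4[of j] 1 by (auto simp: * pderiv_pullback)
qed

lemma \<phi>\<phi>_commute: "p \<in> M \<Longrightarrow> \<phi>\<phi> 4 3 p = \<phi>\<phi> 3 4 p"
  unfolding pderiv_coord_def by (rule dderiv_commute[OF open_M _ smooth_u])

lemma metric_comp_rt:
  "metric_comp g p i j = base_metric a i j - (p $ 2)\<^sup>2 / (u p)\<^sup>2 * angular i j"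
  using exhaust_4[of i] exhaust_4[of j]
  by (elim disjE)
     (simp_all add: metric_comp_def rt_metric_def u_def base_metric_def angular_def Let_def)

lemma inv_metric_rt:
  assumes "p \<in> M"
  shows "inv_metric g p i j = inv_base_metric a i j - (u p)\<^sup>2 / (p $ 2)\<^sup>2 * angular i j"
proof -
  let ?B = "(\<chi> i j. inv_base_metric a i j - (u p)\<^sup>2 / (p $ 2)\<^sup>2 * angular i j) :: real ^ 4 ^ 4"
  have "g p = (\<chi> i j. base_metric a i j - (p $ 2)\<^sup>2 / (u p)\<^sup>2 * angular i j)"
    by (simp add: vec_eq_iff metric_comp_rt[unfolded metric_comp_def])
  then have "g p ** ?B = mat 1"
    using nonzero[OF assms]
    by (simp add: vec_eq_iff forall_4 matrix_matrix_mult_def mat_def sum_4 base_metric_def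
        inv_base_metric_def angular_def)
  then have "matrix_inv (g p) = ?B" by (rule matrix_inv_eqI)
  then show ?thesis by (simp add: inv_metric_def)
qed

lemma pderiv_coord_metric:
  assumes "p \<in> M"
  shows "pderiv_coord m (\<lambda>q. metric_comp g q i j) p =
    (2 * (p $ 2)\<^sup>2 * \<phi> m p / (u p) ^ 3 - 2 * p $ 2 * of_bool (m = 2) / (u p)\<^sup>2) * angular i j"
  unfolding pderiv_coord_def metric_comp_rt
  by (rule dderiv_eqI)
     (auto intro!: derivative_eq_intros has_dderiv smooth_on_differentiable[OF smooth_u] assms
       simp: nonzero[OF assms] axis_def field_simps power2_eq_square power3_eq_cube)

section \<open>Curvature\<close>

text \<open>
  The first summand is the second fundamental form of the fibres, directed along the gradient
  of \<open>r\<close>, whose components are \<open>\<gamma>\<^sup>k\<^sup>2\<close>; the second comes from the scaling by \<open>r\<^sup>2\<close>; the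
  third is the connection of the conformally flat fibre metric.  A single formula in \<open>\<delta>\<close>-symbols
  means that the Christoffel symbols have to be differentiated only once.
\<close>
definition \<Gamma> :: "real ^ 4 \<Rightarrow> 4 \<Rightarrow> 4 \<Rightarrow> 4 \<Rightarrow> real" where
  "\<Gamma> p k i j =
     p $ 2 / (u p)\<^sup>2 * angular i j * inv_base_metric a k 2
     + (of_bool (i = 2) * angular k j + of_bool (j = 2) * angular k i) / p $ 2
     - (angular k i * \<phi> j p + angular k j * \<phi> i p - angular i j * \<phi> k p) / u p"

lemma christoffel_rt:
  assumes "p \<in> M"
  shows "christoffel g p k i j = \<Gamma> p k i j"
  using exhaust_4[of i] exhaust_4[of j] exhaust_4[of k] nonzero[OF assms]
  by (elim disjE)
     (simp_all add: christoffel_def pderiv_coord_metric[OF assms] inv_metric_rt[OF assms] sum_4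
       \<Gamma>_def angular_def inv_base_metric_def \<phi>_simps field_simps power2_eq_square power3_eq_cube)

lemma pderiv_coord_christoffel:
  assumes "p \<in> M"
  shows "pderiv_coord m (\<lambda>q. christoffel g q k i j) p =
     (of_bool (m = 2) / (u p)\<^sup>2 - 2 * p $ 2 * \<phi> m p / (u p) ^ 3) * angular i j * inv_base_metric a k 2
     - of_bool (m = 2) * (of_bool (i = 2) * angular k j + of_bool (j = 2) * angular k i) / (p $ 2)\<^sup>2
     + \<phi> m p * (angular k i * \<phi> j p + angular k j * \<phi> i p - angular i j * \<phi> k p) / (u p)\<^sup>2
     - (angular k i * \<phi>\<phi> m j p + angular k j * \<phi>\<phi> m i p - angular i j * \<phi>\<phi> m k p) / u p"
    (is "_ = ?rhs")
proof -
  have axis: "axis m (1::real) $ 2 = of_bool (m = 2)"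
    by (simp add: axis_def)
  have line: "((\<lambda>t. (p + t *\<^sub>R v) $ 2) has_real_derivative v $ 2) (at 0)" for v
    by (auto intro!: derivative_eq_intros)
  have "pderiv_coord m (\<lambda>q. christoffel g q k i j) p = pderiv_coord m (\<lambda>q. \<Gamma> q k i j) p"
    by (rule pderiv_coord_cong[OF open_M assms christoffel_rt])
  also have "\<dots> = ?rhs"
    unfolding \<Gamma>_def pderiv_coord_def[of m]
    by (rule dderiv_eqI,
        (rule derivative_eq_intros has_dderiv[OF smooth_on_differentiable[OF smooth_u assms]]
           has_dderiv[OF smooth_on_differentiable[OF smooth_\<phi> assms]] line
         | simp add: nonzero[OF assms])+,
        simp add: nonzero[OF assms] axis field_simps power2_eq_square power3_eq_cube power4_eq_xxxx)
  finally show ?thesis .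
qed

text \<open>
  The sectional curvature \<open>(F\<^sub>1 - 2 a) / r\<^sup>2\<close> of the fibre plane times \<open>r\<^sup>2 / f\<^sup>2\<close>, the coefficient of
  \<open>- \<pi>\<close> in the metric.
\<close>
definition \<rho> :: "real ^ 4 \<Rightarrow> real" where
  "\<rho> p = (F1 f (p $ 3, p $ 4) - 2 * a) / (u p)\<^sup>2"

lemma F1_pullback: "F1 f (p $ 3, p $ 4) = (\<phi> 3 p)\<^sup>2 + (\<phi> 4 p)\<^sup>2 - u p * (\<phi>\<phi> 3 3 p + \<phi>\<phi> 4 4 p)"
  unfolding u_def[abs_def] pderiv_pullback by (simp add: F1_def)

lemma \<Gamma>_table:
  "\<Gamma> p 1 i j = p $ 2 / (u p)\<^sup>2 * angular i j"
  "\<Gamma> p 2 i j = 2 * a * p $ 2 / (u p)\<^sup>2 * angular i j"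
  "\<Gamma> p 3 1 j = 0" "\<Gamma> p 3 j 1 = 0" "\<Gamma> p 4 1 j = 0" "\<Gamma> p 4 j 1 = 0"
  "\<Gamma> p 3 2 j = of_bool (j = 3) / p $ 2" "\<Gamma> p 3 j 2 = of_bool (j = 3) / p $ 2"
  "\<Gamma> p 4 2 j = of_bool (j = 4) / p $ 2" "\<Gamma> p 4 j 2 = of_bool (j = 4) / p $ 2"
  "\<Gamma> p 3 3 3 = - \<phi> 3 p / u p" "\<Gamma> p 3 3 4 = - \<phi> 4 p / u p"
  "\<Gamma> p 3 4 3 = - \<phi> 4 p / u p" "\<Gamma> p 3 4 4 = \<phi> 3 p / u p"
  "\<Gamma> p 4 3 3 = \<phi> 4 p / u p" "\<Gamma> p 4 3 4 = - \<phi> 3 p / u p"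
  "\<Gamma> p 4 4 3 = - \<phi> 3 p / u p" "\<Gamma> p 4 4 4 = - \<phi> 4 p / u p"
  by (auto simp: \<Gamma>_def angular_def inv_base_metric_def \<phi>_simps)

lemma angular_simps:
  "angular 1 j = 0" "angular 2 j = 0" "angular j 1 = 0" "angular j 2 = 0"
  "angular 3 3 = 1" "angular 3 4 = 0" "angular 4 3 = 0" "angular 4 4 = 1"
  by (auto simp: angular_def)

text \<open>
  The second derivatives of \<open>u\<close> enter only through the Laplacian in \<open>F\<^sub>1\<close>: the mixed ones
  cancel by Schwarz's theorem.  Contributions containing \<open>r\<close> cancel because \<open>r\<close> is
  linear on the flat base, except for the term \<open>2 a\<close> contributed by the norm of \<open>dr\<close>.
\<close>
lemma curvature_operator:
  assumes "p \<in> M"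
  shows "pderiv_coord k (\<lambda>y. christoffel g y i j l) p - pderiv_coord l (\<lambda>y. christoffel g y i j k) p
     + (\<Sum>m\<in>UNIV. christoffel g p m j l * christoffel g p i m k - christoffel g p m j k * christoffel g p i m l)
     = \<rho> p * (angular i l * angular j k - angular i k * angular j l)"
  using exhaust_4[of i] exhaust_4[of j] exhaust_4[of k] exhaust_4[of l]
  unfolding pderiv_coord_christoffel[OF assms] christoffel_rt[OF assms]
  by (elim disjE)
     (simp_all add: \<rho>_def F1_pullback sum_4 \<Gamma>_table angular_simps inv_base_metric_def
        \<phi>_simps \<phi>\<phi>_simps \<phi>\<phi>_commute[OF assms] nonzero[OF assms],
      simp_all add: nonzero[OF assms] field_simps power2_eq_square power3_eq_cube power4_eq_xxxx)

lemma riemann_rt: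
  assumes "p \<in> M"
  shows "riemann g p i j k l =
    \<rho> p * ((p $ 2)\<^sup>2 / (u p)\<^sup>2) * (angular i k * angular j l - angular i l * angular j k)"
  unfolding riemann_def curvature_operator[OF assms] metric_comp_rt
  using exhaust_4[of i]
  by (elim disjE) (simp_all add: sum_4 angular_def base_metric_def algebra_simps)

lemma ricci_rt:
  assumes "p \<in> M"
  shows "ricci g p j k = \<rho> p * angular j k"
  unfolding ricci_def riemann_rt[OF assms] inv_metric_rt[OF assms]
  using exhaust_4[of j] exhaust_4[of k] nonzero[OF assms]
  by (elim disjE) (simp_all add: sum_4 angular_def inv_base_metric_def field_simps)

text \<open>The \<open>\<pi> \<and> \<pi>\<close> part of \<open>(1/2) S \<and> g\<close> is exactly \<open>R\<close>, so only the base metric remains.\<close>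
lemma conharmonic_rt:
  assumes "p \<in> M"
  shows "conharmonic g p i j k l =
    \<rho> p * (- (1 / 2) * kulkarni_nomizu (\<lambda>_. angular) (\<lambda>_. base_metric a) p i j k l)"
  unfolding conharmonic_def kulkarni_nomizu_def riemann_rt[OF assms] ricci_rt[OF assms] metric_comp_rt
  by (simp add: algebra_simps add_divide_distrib diff_divide_distrib)

section \<open>The inheritance factor\<close>

definition inheritance_factor :: "real \<times> real \<Rightarrow> real" where
  "inheritance_factor z =
     (- 4 * a * Dx f z + 2 * Dy f z ^ 2 * Dx f z - f z * Dy (Dy f) z * Dx f z + 2 * Dx f z ^ 3
        - 2 * f z * Dy f z * Dy (Dx f) z + f z ^ 2 * Dy (Dy (Dx f)) z
        - 3 * f z * Dx f z * Dx (Dx f) z + f z ^ 2 * Dx (Dx (Dx f)) z)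
     / (f z * (2 * a - F1 f z))"

lemma Dx_eqI: "((\<lambda>t. h (z + t *\<^sub>R (1, 0))) has_real_derivative c) (at 0) \<Longrightarrow> Dx h z = c"
  unfolding Dx_def by (rule dderiv_eqI)

lemma has_Dx:
  "smooth_on S h \<Longrightarrow> z \<in> S \<Longrightarrow>
    ((\<lambda>t. h (z + t *\<^sub>R (1, 0))) has_real_derivative Dx h z) (at 0)"
  unfolding Dx_def by (rule has_dderiv[OF smooth_on_differentiable])

lemma smooth_partials:
  assumes "smooth_on S h"
  shows "smooth_on S (Dx h)" "smooth_on S (Dy h)"
  unfolding Dx_def Dy_def by (rule smooth_on_dderiv[OF assms])+

lemma smooth_F1: "smooth_on \<Omega> (F1 f)"
  unfolding F1_def[abs_def] by (intro smooth_intros open_\<Omega> smooth_f smooth_partials)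

lemma smooth_inheritance_factor:
  assumes "\<And>z. z \<in> \<Omega> \<Longrightarrow> F1 f z - 2 * a \<noteq> 0"
  shows "smooth_on M (\<lambda>p. inheritance_factor (p $ 3, p $ 4))"
proof (rule smooth_on_pullback)
  note smooth = smooth_f smooth_f[THEN smooth_partials(1)] smooth_f[THEN smooth_partials(2)]
  note smooth2 = smooth(2)[THEN smooth_partials(1)] smooth(2)[THEN smooth_partials(2)]
    smooth(3)[THEN smooth_partials(2)]
  have "f z * (2 * a - F1 f z) \<noteq> 0" if "z \<in> \<Omega>" for z
    using assms[OF that] f_nonzero[OF that] by simp
  then show "smooth_on \<Omega> inheritance_factor"
    unfolding inheritance_factor_def[abs_def]
    by (intro smooth_intros open_\<Omega> smooth smooth2 smooth_F1
        smooth2(1)[THEN smooth_partials(1)] smooth2(2)[THEN smooth_partials(2)])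
qed

lemma smooth_curvature_scalar: "smooth_on \<Omega> (\<lambda>z. (F1 f z - 2 * a) / (f z)\<^sup>2)"
  by (intro smooth_intros open_\<Omega> smooth_F1 smooth_f) (simp add: f_nonzero)

text \<open>Differentiating \<open>F\<^sub>1\<close> puts \<open>\<partial>\<^sub>x\<close> outermost; Schwarz's theorem moves it innermost.\<close>
lemma Dx_F1:
  assumes "z \<in> \<Omega>"
  shows "Dx (F1 f) z = 2 * Dx f z * Dx (Dx f) z + 2 * Dy f z * Dy (Dx f) z
    - Dx f z * (Dx (Dx f) z + Dy (Dy f) z) - f z * (Dx (Dx (Dx f)) z + Dy (Dy (Dx f)) z)"
proof -
  have commute: "Dx (Dy h) w = Dy (Dx h) w" if "smooth_on \<Omega> h" "w \<in> \<Omega>" for h w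
    unfolding Dx_def Dy_def using dderiv_commute open_\<Omega> that by blast
  have Dy_cong: "Dy h z = Dy k z" if "\<And>w. w \<in> \<Omega> \<Longrightarrow> h w = k w" for h k
    unfolding Dy_def using open_\<Omega> assms that by (rule dderiv_cong)
  have "Dx (Dy (Dy f)) z = Dy (Dx (Dy f)) z"
    by (rule commute[OF smooth_partials(2)[OF smooth_f] assms])
  also have "\<dots> = Dy (Dy (Dx f)) z"
    by (rule Dy_cong[OF commute[OF smooth_f]])
  finally have third: "Dx (Dy (Dy f)) z = Dy (Dy (Dx f)) z" .
  have "Dx (F1 f) z = 2 * Dx f z * Dx (Dx f) z + 2 * Dy f z * Dx (Dy f) z
    - Dx f z * (Dx (Dx f) z + Dy (Dy f) z) - f z * (Dx (Dx (Dx f)) z + Dx (Dy (Dy f)) z)"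
    unfolding F1_def[abs_def]
    by (rule Dx_eqI, (rule derivative_eq_intros has_Dx[OF _ assms] smooth_f smooth_partials | simp)+)
       (simp add: algebra_simps flip: zero_prod_def)
  then show ?thesis
    by (simp only: commute[OF smooth_f assms] third)
qed

text \<open>
  The factor is \<open>\<partial>\<^sub>x F\<^sub>1 / (F\<^sub>1 - 2 a) - 2 f\<^sub>x / f\<close>, the logarithmic derivative of
  \<open>(F\<^sub>1 - 2 a) / f\<^sup>2\<close>, over a common denominator.
\<close>
lemma Dx_curvature_scalar:
  assumes "z \<in> \<Omega>" "F1 f z - 2 * a \<noteq> 0"
  shows "Dx (\<lambda>z. (F1 f z - 2 * a) / (f z)\<^sup>2) z = inheritance_factor z * ((F1 f z - 2 * a) / (f z)\<^sup>2)"
proof -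
  have nz: "f z \<noteq> 0" "f z * (2 * a - F1 f z) \<noteq> 0"
    using f_nonzero assms by auto
  note numerator = iffD1[OF nonzero_eq_divide_eq[OF nz(2)] inheritance_factor_def[of z]]
  have "Dx (\<lambda>z. (F1 f z - 2 * a) / (f z)\<^sup>2) z
      = (f z * Dx (F1 f) z - 2 * Dx f z * (F1 f z - 2 * a)) / (f z) ^ 3"
    by (rule Dx_eqI,
        (rule derivative_eq_intros has_Dx[OF smooth_F1 assms(1)] has_Dx[OF smooth_f assms(1)]
         | simp add: nz flip: zero_prod_def)+)
       (simp add: nz field_simps power2_eq_square power3_eq_cube power4_eq_xxxx)
  also have "f z * Dx (F1 f) z - 2 * Dx f z * (F1 f z - 2 * a)
      = - (inheritance_factor z * (f z * (2 * a - F1 f z)))"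
    unfolding numerator Dx_F1[OF assms(1)]
    by (simp add: F1_def power2_eq_square power3_eq_cube algebra_simps)
  also have "- (inheritance_factor z * (f z * (2 * a - F1 f z))) / (f z) ^ 3
      = inheritance_factor z * ((F1 f z - 2 * a) / (f z)\<^sup>2)"
    using nz(1) by (simp add: field_simps power2_eq_square power3_eq_cube)
  finally show ?thesis .
qed

lemma conharmonic_inheritance_rt:
  assumes "\<And>z. z \<in> \<Omega> \<Longrightarrow> F1 f z - 2 * a \<noteq> 0"
  shows "conharmonic_inheritance M g (coord_field 3) (\<lambda>p. inheritance_factor (p $ 3, p $ 4))"
  unfolding conharmonic_inheritance_def
proof (intro conjI ballI allI)
  show "smooth_on M (\<lambda>p. inheritance_factor (p $ 3, p $ 4))"
    by (rule smooth_inheritance_factor[OF assms])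
  fix p i j k l
  assume p: "p \<in> M"
  let ?z = "(p $ 3, p $ 4)"
  let ?C = "- (1 / 2) * kulkarni_nomizu (\<lambda>_. angular) (\<lambda>_. base_metric a) p i j k l"
  have z: "?z \<in> \<Omega>"
    using p by (simp add: rt_manifold_def)
  have "lie_deriv4 (coord_field 3) (conharmonic g) p i j k l
      = pderiv_coord 3 (\<lambda>q. (F1 f (q $ 3, q $ 4) - 2 * a) / (f (q $ 3, q $ 4))\<^sup>2 * ?C) p"
    unfolding lie_deriv4_coord_field
    by (rule pderiv_coord_cong[OF open_M p])
       (simp add: conharmonic_rt \<rho>_def u_def kulkarni_nomizu_def)
  also have "\<dots> = Dx (\<lambda>z. (F1 f z - 2 * a) / (f z)\<^sup>2 * ?C) ?z"
    by (rule pderiv_pullback(3))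
  also have "\<dots> = Dx (\<lambda>z. (F1 f z - 2 * a) / (f z)\<^sup>2) ?z * ?C"
    by (rule Dx_eqI, rule DERIV_cmult_right, rule has_Dx[OF smooth_curvature_scalar z])
  also have "\<dots> = inheritance_factor ?z * conharmonic g p i j k l"
    by (simp only: Dx_curvature_scalar[OF z assms[OF z]] conharmonic_rt[OF p] \<rho>_def u_def mult.assoc)
  finally show "lie_deriv4 (coord_field 3) (conharmonic g) p i j k l
      = inheritance_factor ?z * conharmonic g p i j k l" .
qed

end

theorem corollary4p7:
  fixes a b d :: real
    and I J :: "real set"
    and \<Omega> :: "(real \<times> real) set"
    and f :: "real \<times> real \<Rightarrow> real"
  assumes "open I" "is_interval I" "I \<noteq> {}"
    and "open J" "is_interval J" "J \<noteq> {}" "0 \<notin> J"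
    and "open \<Omega>" "connected \<Omega>" "\<Omega> \<noteq> {}"
    and "smooth_on \<Omega> f" "\<forall>z\<in>\<Omega>. f z \<noteq> 0"
    and "b = 0" "d = 0"
    and "\<forall>p\<in>rt_manifold I J \<Omega>. F1 f (p $ 3, p $ 4) - 2 * a \<noteq> 0"
    and "\<forall>p\<in>rt_manifold I J \<Omega>. p $ 2 * F1 f (p $ 3, p $ 4) - 2 * a * p $ 2 \<noteq> 0"
  shows "conharmonic_inheritance (rt_manifold I J \<Omega>) (rt_metric a b d f) (coord_field 3)
    (\<lambda>p. let z = (p $ 3, p $ 4);
             f0 = f z; fx = Dx f z; fy = Dy f z;
             fxx = Dx (Dx f) z; fxy = Dy (Dx f) z; fyy = Dy (Dy f) z;
             fxxx = Dx (Dx (Dx f)) z; fxyy = Dy (Dy (Dx f)) z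
         in (- 4 * a * fx + 2 * fy ^ 2 * fx - f0 * fyy * fx + 2 * fx ^ 3 - 2 * f0 * fy * fxy
               + f0 ^ 2 * fxyy - 3 * f0 * fx * fxx + f0 ^ 2 * fxxx)
            / (f0 * (2 * a - F1 f z)))"
proof -
  interpret rt_flat_base a I J \<Omega> f
    using assms by unfold_locales auto
  \<comment> \<open>Nonemptiness of \<open>I\<close> and \<open>J\<close> puts a point of the chart over every \<open>z \<in> \<Omega>\<close>.\<close>
  have "F1 f z - 2 * a \<noteq> 0" if "z \<in> \<Omega>" for z
  proof -
    obtain t r where "t \<in> I" "r \<in> J"
      using assms by blast
    with that have "(vector [t, r, fst z, snd z] :: real ^ 4) \<in> M"
      by (simp add: rt_manifold_def)
    from bspec[OF assms(15) this] show ?thesis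
      by simp
  qed
  from conharmonic_inheritance_rt[OF this] show ?thesis
    by (simp only: inheritance_factor_def Let_def \<open>b = 0\<close> \<open>d = 0\<close>)
qed

end
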